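(* Let $P$ be a connected finite poset with at least two points and let $C\subseteq E(P)$ be a 4-crown of $P$ with $L(C)=\{a,b\}$, $U(C)=\{v,w\}$. There exists a $C$-separating homomorphism from $\mathfrak{F}(P)$ to $\mathfrak{C}$ if and only if there exists a $C$-separating homomorphism from $\mathfrak{F}(P)$ to $\mathfrak{C}_3$.
   Context: All posets are finite; subsets are identified with induced subposets. $L(P)$, $U(P)$: minimal and maximal points of $P$; $E(P)=L(P)\cup U(P)$. $[x,y]_P=\{z: x\leq_P z\leq_P y\}$. A crown is a subset whose comparability graph is a cycle; a 4-crown $D=\{a,b,v,w\}$ with $L(D)=\{a,b\}$, $U(D)=\{v,w\}$ is improper if $[a,v]_P\cap[b,w]_P\neq\emptyset$. $\mathcal{C}_{23}$: the subsets of $C$ with 2 or 3 elements which are connected as induced subposets of $C$ (the four comparable pairs and $abv,abw,avw,bvw$, where $xyz=\{x,y,z\}$). $\mathfrak{C}$: multigraph on $\mathcal{C}_{23}$ with an L-edge between $S,T$ (loops allowed) iff $L(C)\cap S\cap T\neq\emptyset$ and a U-edge iff $U(C)\cap S\cap T\neq\emptyset$. $\mathcal{C}_3=\{S\in\mathcal{C}_{23}:\#S=3\}$ and $\mathfrak{C}_3$ is the sub-multigraph of $\mathfrak{C}$ induced by $\mathcal{C}_3$. $\mathcal{A},\mathcal{B},\mathcal{V},\mathcal{W}$ are the sets of $S\in\mathcal{C}_{23}$ with $L(C)\cap S=\{a\}$, $L(C)\cap S=\{b\}$, $U(C)\cap S=\{v\}$, $U(C)\cap S=\{w\}$ respectively.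 $\mathcal{F}(P)$: the set of improper 4-crowns of $P$ contained in $E(P)$; $\mathfrak{F}(P)$: multigraph on $\mathcal{F}(P)$ with L-edge between $F,G$ iff $L(P)\cap F\cap G\neq\emptyset$ and U-edge iff $U(P)\cap F\cap G\neq\emptyset$. A homomorphism $\phi$ from $\mathfrak{F}(P)$ to $\mathfrak{C}$ (resp. $\mathfrak{C}_3$) is a map $\mathcal{F}(P)\to\mathcal{C}_{23}$ (resp. $\to\mathcal{C}_3$) sending L-edges to L-edges and U-edges to U-edges. $\phi$ is $C$-separating if there exist $x\neq x'$ in $L(P)$ and $y\neq y'$ in $U(P)$ with $\{x,x',y,y'\}=C$ such that for all $F\in\mathcal{F}(P)$: $x\in F\Rightarrow\phi(F)\notin\mathcal{A}$; $x'\in F\Rightarrow\phi(F)\notin\mathcal{B}$; $y\in F\Rightarrow\phi(F)\notin\mathcal{V}$; $y'\in F\Rightarrow\phi(F)\notin\mathcal{W}$. *)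

theory Defs
  imports "HOL-Library.FuncSet"
begin

text \<open>
  A finite poset is a finite carrier set together with its order relation \<open>r\<close>
  (\<open>(x, y) \<in> r\<close> means \<open>x \<le> y\<close>), related by \<^const>\<open>partial_order_on\<close>. A subset \<open>S\<close> of the carrier
  stands for the subposet induced on it; all notions below refer to \<open>r\<close> only through its
  restriction to the given set, so one \<open>r\<close> serves for the poset and all its induced subposets.
\<close>

definition min_points :: "'a rel \<Rightarrow> 'a set \<Rightarrow> 'a set" where
  "min_points r S = {x \<in> S. \<forall>y\<in>S. (y, x) \<in> r \<longrightarrow> y = x}"

definition max_points :: "'a rel \<Rightarrow> 'a set \<Rightarrow> 'a set" where
  "max_points r S = {x \<in> S. \<forall>y\<in>S. (x, y) \<in> r \<longrightarrow> y = x}"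

definition extremal_points :: "'a rel \<Rightarrow> 'a set \<Rightarrow> 'a set" where
  "extremal_points r S = min_points r S \<union> max_points r S"

definition interval :: "'a rel \<Rightarrow> 'a set \<Rightarrow> 'a \<Rightarrow> 'a \<Rightarrow> 'a set" where
  "interval r P x y = {z \<in> P. (x, z) \<in> r \<and> (z, y) \<in> r}"

definition connected_poset :: "'a rel \<Rightarrow> 'a set \<Rightarrow> bool" where
  "connected_poset r S \<longleftrightarrow> (\<forall>x\<in>S. \<forall>y\<in>S. (x, y) \<in> (Restr (r \<union> r\<inverse>) S)\<^sup>*)"

definition comparability_edge :: "'a rel \<Rightarrow> 'a \<Rightarrow> 'a \<Rightarrow> bool" where
  "comparability_edge r x y \<longleftrightarrow> x \<noteq> y \<and> ((x, y) \<in> r \<or> (y, x) \<in> r)"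

text \<open>
  The comparability graph of \<open>S\<close> is a cycle: the points can be listed cyclically, without
  repetition, so that exactly the cyclically consecutive ones are adjacent.
\<close>

definition crown :: "'a rel \<Rightarrow> 'a set \<Rightarrow> bool" where
  "crown r S \<longleftrightarrow>
    (\<exists>cs. distinct cs \<and> set cs = S \<and> length cs \<ge> 3 \<and>
      (\<forall>i<length cs. \<forall>j<length cs.
        comparability_edge r (cs ! i) (cs ! j) \<longleftrightarrow>
          j = Suc i mod length cs \<or> i = Suc j mod length cs))"

definition four_crown :: "'a rel \<Rightarrow> 'a set \<Rightarrow> bool" where
  "four_crown r D \<longleftrightarrow> crown r D \<and> card D = 4"

text \<open>
  Since \<open>a\<close>, \<open>b\<close> both lie below \<open>v\<close>, \<open>w\<close> in a 4-crown, the condition on the intervals does not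
  depend on how the minimal and maximal points are named.
\<close>

definition improper_four_crown :: "'a rel \<Rightarrow> 'a set \<Rightarrow> 'a set \<Rightarrow> bool" where
  "improper_four_crown r P D \<longleftrightarrow>
    four_crown r D \<and> D \<subseteq> P \<and>
    (\<exists>a b v w. min_points r D = {a, b} \<and> max_points r D = {v, w} \<and>
      interval r P a v \<inter> interval r P b w \<noteq> {})"

text \<open>
  Multigraphs with two kinds of undirected edges, loops allowed, and at most one edge of each
  kind between two vertices; each kind is a symmetric relation on the vertex set.
\<close>

record 'v lu_graph =
  lu_verts :: "'v set"
  l_edges :: "'v rel"
  u_edges :: "'v rel"

definition intersection_lu_graph :: "'a rel \<Rightarrow> 'a set \<Rightarrow> 'a set set \<Rightarrow> 'a set lu_graph" where
  "intersection_lu_graph r Q \<V> =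
    \<lparr> lu_verts = \<V>,
      l_edges = {(S, T). S \<in> \<V> \<and> T \<in> \<V> \<and> min_points r Q \<inter> S \<inter> T \<noteq> {}},
      u_edges = {(S, T). S \<in> \<V> \<and> T \<in> \<V> \<and> max_points r Q \<inter> S \<inter> T \<noteq> {}} \<rparr>"

definition induced_lu_graph :: "'v lu_graph \<Rightarrow> 'v set \<Rightarrow> 'v lu_graph" where
  "induced_lu_graph G W =
    \<lparr> lu_verts = lu_verts G \<inter> W,
      l_edges = Restr (l_edges G) W,
      u_edges = Restr (u_edges G) W \<rparr>"

definition lu_hom :: "'v lu_graph \<Rightarrow> 'w lu_graph \<Rightarrow> ('v \<Rightarrow> 'w) \<Rightarrow> bool" where
  "lu_hom G H \<phi> \<longleftrightarrow>
    \<phi> \<in> lu_verts G \<rightarrow> lu_verts H \<and>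
    (\<forall>(S, T) \<in> l_edges G. (\<phi> S, \<phi> T) \<in> l_edges H) \<and>
    (\<forall>(S, T) \<in> u_edges G. (\<phi> S, \<phi> T) \<in> u_edges H)"

definition C23 :: "'a rel \<Rightarrow> 'a set \<Rightarrow> 'a set set" where
  "C23 r C = {S. S \<subseteq> C \<and> card S \<in> {2, 3} \<and> connected_poset r S}"

definition C3 :: "'a rel \<Rightarrow> 'a set \<Rightarrow> 'a set set" where
  "C3 r C = {S \<in> C23 r C. card S = 3}"

definition C23_graph :: "'a rel \<Rightarrow> 'a set \<Rightarrow> 'a set lu_graph" where
  "C23_graph r C = intersection_lu_graph r C (C23 r C)"

definition C3_graph :: "'a rel \<Rightarrow> 'a set \<Rightarrow> 'a set lu_graph" where
  "C3_graph r C = induced_lu_graph (C23_graph r C) (C3 r C)"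

text \<open>
  With \<open>{a, b}\<close> the minimal and \<open>{v, w}\<close> the maximal points of \<open>C\<close>, the classes
  \<open>\<A>\<close>, \<open>\<B>\<close> are \<open>lower_class r C a\<close>, \<open>lower_class r C b\<close>, and \<open>\<V>\<close>, \<open>\<W>\<close> are
  \<open>upper_class r C v\<close>, \<open>upper_class r C w\<close>.
\<close>

definition lower_class :: "'a rel \<Rightarrow> 'a set \<Rightarrow> 'a \<Rightarrow> 'a set set" where
  "lower_class r C c = {S \<in> C23 r C. min_points r C \<inter> S = {c}}"

definition upper_class :: "'a rel \<Rightarrow> 'a set \<Rightarrow> 'a \<Rightarrow> 'a set set" where
  "upper_class r C c = {S \<in> C23 r C. max_points r C \<inter> S = {c}}"

definition improper_extremal_crowns :: "'a rel \<Rightarrow> 'a set \<Rightarrow> 'a set set" where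
  "improper_extremal_crowns r P =
    {F. improper_four_crown r P F \<and> F \<subseteq> extremal_points r P}"

definition crown_graph :: "'a rel \<Rightarrow> 'a set \<Rightarrow> 'a set lu_graph" where
  "crown_graph r P = intersection_lu_graph r P (improper_extremal_crowns r P)"

definition C_separating ::
  "'a rel \<Rightarrow> 'a set \<Rightarrow> 'a set \<Rightarrow> 'a \<Rightarrow> 'a \<Rightarrow> 'a \<Rightarrow> 'a \<Rightarrow> ('a set \<Rightarrow> 'a set) \<Rightarrow> bool" where
  "C_separating r P C a b v w \<phi> \<longleftrightarrow>
    (\<exists>x x' y y'.
      x \<in> min_points r P \<and> x' \<in> min_points r P \<and> x \<noteq> x' \<and>
      y \<in> max_points r P \<and> y' \<in> max_points r P \<and> y \<noteq> y' \<and>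
      {x, x', y, y'} = C \<and>
      (\<forall>F \<in> improper_extremal_crowns r P.
        (x \<in> F \<longrightarrow> \<phi> F \<notin> lower_class r C a) \<and>
        (x' \<in> F \<longrightarrow> \<phi> F \<notin> lower_class r C b) \<and>
        (y \<in> F \<longrightarrow> \<phi> F \<notin> upper_class r C v) \<and>
        (y' \<in> F \<longrightarrow> \<phi> F \<notin> upper_class r C w)))"

end

theory Submission
  imports Defs
begin

text \<open>
  Every two-element member \<open>S\<close> of \<open>C23 r C\<close> lies in a three-element one. Enlarging the values of
  \<open>\<phi>\<close> keeps all edges, because edges mean non-empty intersections. It also keeps separation: \<open>S\<close>
  already meets both levels of \<open>C\<close>, so a set containing \<open>S\<close> and meeting a level of \<open>C\<close> in a single
  point meets it in the same point as \<open>S\<close>.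
\<close>

lemma comparability_edge_commute: "comparability_edge r x y \<longleftrightarrow> comparability_edge r y x"
  by (auto simp: comparability_edge_def)

text \<open>Trades the indices modulo 4 for four named points: neighbours in the cycle are
  comparable, and the opposite pairs \<open>c0\<close>, \<open>c2\<close> and \<open>c1\<close>,
  \<open>c3\<close> are not.\<close>

lemma four_crown_cycle:
  assumes "four_crown r C"
  obtains c0 c1 c2 c3 where "C = {c0, c1, c2, c3}" "distinct [c0, c1, c2, c3]"
    "comparability_edge r c0 c1" "comparability_edge r c1 c2"
    "comparability_edge r c2 c3" "comparability_edge r c3 c0"
    "\<not> comparability_edge r c0 c2" "\<not> comparability_edge r c1 c3"
proof -
  obtain cs where cs: "distinct cs" "set cs = C" and
    edge: "\<And>i j. i < length cs \<Longrightarrow> j < length cs \<Longrightarrow>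
        comparability_edge r (cs ! i) (cs ! j) \<longleftrightarrow>
          j = Suc i mod length cs \<or> i = Suc j mod length cs"
    using assms unfolding four_crown_def crown_def by blast
  have "length cs = 4"
    using assms cs distinct_card unfolding four_crown_def by metis
  then obtain c0 c1 c2 c3 where eq: "cs = [c0, c1, c2, c3]"
    by (auto simp: length_Suc_conv numeral_eq_Suc)
  show thesis
  proof
    show "C = {c0, c1, c2, c3}" "distinct [c0, c1, c2, c3]" using cs eq by auto
    show "comparability_edge r c0 c1" "comparability_edge r c1 c2"
      "comparability_edge r c2 c3" "comparability_edge r c3 c0"
      "\<not> comparability_edge r c0 c2" "\<not> comparability_edge r c1 c3"
      using edge[of 0 1] edge[of 1 2] edge[of 2 3] edge[of 3 0] edge[of 0 2] edge[of 1 3]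
      by (simp_all add: eq)
  qed
qed

text \<open>Each comparability switches between the opposite pairs \<open>{c0, c2}\<close> and
  \<open>{c1, c3}\<close>. After two switches \<open>x\<close> and \<open>z\<close> lie in the same
  pair, so they are equal or opposite, and neither case is an edge.\<close>

lemma four_crown_triangle_free:
  assumes "four_crown r C" "x \<in> C" "y \<in> C" "z \<in> C"
    and "comparability_edge r x y" "comparability_edge r y z"
  shows "\<not> comparability_edge r x z"
proof -
  obtain c0 c1 c2 c3 where C: "C = {c0, c1, c2, c3}"
    and "\<not> comparability_edge r c0 c2" "\<not> comparability_edge r c1 c3"
    using assms(1) by (rule four_crown_cycle)
  moreover have "\<not> comparability_edge r u u" for u
    by (simp add: comparability_edge_def)
  ultimately show ?thesis
    using assms(2-) comparability_edge_commute[of r c2 c0] comparability_edge_commute[of r c3 c1]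
    unfolding C by (elim insertE) simp_all
qed

text \<open>A point of a 4-cycle has two distinct neighbours, and an arbitrary \<open>q\<close> can
  coincide with at most one of them.\<close>

lemma four_crown_other_neighbour:
  assumes "four_crown r C" "p \<in> C"
  obtains z where "z \<in> C" "z \<noteq> q" "comparability_edge r p z"
proof -
  note that' = that
  obtain c0 c1 c2 c3 where C: "C = {c0, c1, c2, c3}" "distinct [c0, c1, c2, c3]"
    and edges: "comparability_edge r c0 c1" "comparability_edge r c1 c2"
      "comparability_edge r c2 c3" "comparability_edge r c3 c0"
    using assms(1) by (rule four_crown_cycle)
  have two: thesis if "x \<in> C" "y \<in> C" "x \<noteq> y"
    "comparability_edge r p x" "comparability_edge r p y" for x y
    using that that' by metis
  note edges = edges edges[THEN comparability_edge_commute[THEN iffD1]]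
  consider "p = c0" | "p = c1" | "p = c2" | "p = c3" using assms(2) C(1) by blast
  then show thesis
  proof cases
    case 1
    then show ?thesis using two[of c1 c3] C edges by simp
  next
    case 2
    then show ?thesis using two[of c0 c2] C edges by simp
  next
    case 3
    then show ?thesis using two[of c1 c3] C edges by simp
  next
    case 4
    then show ?thesis using two[of c0 c2] C edges by simp
  qed
qed

lemma connected_poset_strict_pair:
  assumes "connected_poset r S" "card S \<ge> 2"
  obtains p q where "p \<in> S" "q \<in> S" "p \<noteq> q" "(p, q) \<in> r"
proof -
  obtain p q where pq: "p \<in> S" "q \<in> S" "p \<noteq> q"
    using obtain_subset_with_card_n[OF assms(2)] by (metis card_2_iff insert_subset)
  \<comment> \<open>Without a comparability between distinct points of \<open>S\<close>, paths
    inside \<open>S\<close> never leave their starting point, so \<open>p\<close> and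
    \<open>q\<close> could not be joined.\<close>
  have "(Restr (r \<union> r\<inverse>) S)\<^sup>* \<subseteq> Id" if "Restr (r \<union> r\<inverse>) S \<subseteq> Id"
    using rtrancl_subset_rtrancl[of "Restr (r \<union> r\<inverse>) S" Id] that by auto
  then have "\<not> Restr (r \<union> r\<inverse>) S \<subseteq> Id"
    using assms(1) pq unfolding connected_poset_def by blast
  then show thesis using that by blast
qed

lemma connected_poset_insert:
  assumes "connected_poset r S" "y \<in> S" "comparability_edge r y z"
  shows "connected_poset r (insert z S)"
proof -
  let ?R = "\<lambda>S. Restr (r \<union> r\<inverse>) S"
  have mono: "(?R S)\<^sup>* \<subseteq> (?R (insert z S))\<^sup>*" by (intro rtrancl_mono) auto
  have yz: "(y, z) \<in> ?R (insert z S)" "(z, y) \<in> ?R (insert z S)"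
    using assms(2,3) by (auto simp: comparability_edge_def)
  \<comment> \<open>The attaching point \<open>y\<close> serves as a hub: every point is joined to
    it in both directions, so any two points are joined through it.\<close>
  have "(u, y) \<in> (?R (insert z S))\<^sup>* \<and> (y, u) \<in> (?R (insert z S))\<^sup>*" if "u \<in> insert z S" for u
    using that assms(1,2) mono yz unfolding connected_poset_def by blast
  then show ?thesis unfolding connected_poset_def by (meson rtrancl_trans)
qed

lemma C23_extend:
  assumes "four_crown r C" "S \<in> C23 r C"
  obtains T where "T \<in> C3 r C" "S \<subseteq> T"
proof (cases "card S = 2")
  case False
  then show thesis using assms(2) that[of S] unfolding C23_def C3_def by auto
next
  case True
  have S: "S \<subseteq> C" "connected_poset r S" using assms(2) unfolding C23_def by auto
  obtain p q where pq: "S = {p, q}" "p \<noteq> q"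
    using True by (meson card_2_iff)
  \<comment> \<open>The neighbour of \<open>p\<close> is chosen away from \<open>q\<close>; it also
    differs from \<open>p\<close>, since \<open>comparability_edge\<close> is irreflexive. Hence
    adding it gives exactly three points.\<close>
  obtain z where z: "z \<in> C" "z \<noteq> q" "comparability_edge r p z"
    using four_crown_other_neighbour[OF assms(1)] S(1) pq by blast
  have "connected_poset r (insert z S)"
    using connected_poset_insert[OF S(2) _ z(3)] pq by blast
  moreover have "card (insert z S) = 3"
    using pq z by (auto simp: comparability_edge_def)
  ultimately have "insert z S \<in> C3 r C"
    using S(1) z(1) unfolding C3_def C23_def by auto
  then show thesis using that by blast
qed

text \<open>Being connected with at least two points, \<open>S\<close> contains some
  \<open>p\<close> strictly below some \<open>q\<close>. A third point of \<open>C\<close> below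
  \<open>p\<close> or above \<open>q\<close> would complete a three-element chain, hence a triangle
  in the comparability graph. So \<open>p\<close> is minimal and \<open>q\<close> maximal in
  \<open>C\<close>.\<close>

lemma C23_meets_extremal_points:
  assumes "partial_order_on P r" "four_crown r C" "S \<in> C23 r C"
  shows "min_points r C \<inter> S \<noteq> {}" "max_points r C \<inter> S \<noteq> {}"
proof -
  have trans: "trans r" and antisym: "antisym r"
    using assms(1) by (auto simp: partial_order_on_def preorder_on_def)
  have no_chain: "y = x \<or> z = y" if "x \<in> C" "y \<in> C" "z \<in> C" "(x, y) \<in> r" "(y, z) \<in> r" for x y z
  proof (rule ccontr)
    assume *: "\<not> (y = x \<or> z = y)"
    have "(x, z) \<in> r" using transD[OF trans] that by blast
    moreover have "x \<noteq> z" using antisymD[OF antisym] that * by blast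
    ultimately show False
      using four_crown_triangle_free[OF assms(2) that(1-3)] * that
      by (auto simp: comparability_edge_def)
  qed
  have S: "S \<subseteq> C" "connected_poset r S" "card S \<ge> 2"
    using assms(3) unfolding C23_def by auto
  obtain p q where pq: "p \<in> S" "q \<in> S" "p \<noteq> q" "(p, q) \<in> r"
    using S(2,3) by (rule connected_poset_strict_pair)
  then have "p \<in> min_points r C" "q \<in> max_points r C"
    using no_chain S(1) unfolding min_points_def max_points_def by blast+
  then show "min_points r C \<inter> S \<noteq> {}" "max_points r C \<inter> S \<noteq> {}"
    using pq by auto
qed

theorem theorem2:
  fixes P :: "'a set" and r :: "'a rel" and C :: "'a set" and a b v w :: 'a
  assumes "finite P"
    and "partial_order_on P r"
    and "connected_poset r P"
    and "card P \<ge> 2"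
    and "four_crown r C"
    and "C \<subseteq> extremal_points r P"
    and "min_points r C = {a, b}"
    and "max_points r C = {v, w}"
  shows "(\<exists>\<phi>. lu_hom (crown_graph r P) (C23_graph r C) \<phi> \<and> C_separating r P C a b v w \<phi>) \<longleftrightarrow>
         (\<exists>\<phi>. lu_hom (crown_graph r P) (C3_graph r C) \<phi> \<and> C_separating r P C a b v w \<phi>)"
proof
  assume "\<exists>\<phi>. lu_hom (crown_graph r P) (C3_graph r C) \<phi> \<and> C_separating r P C a b v w \<phi>"
  \<comment> \<open>The same map works, as \<open>C3_graph\<close> is an induced part of
    \<open>C23_graph\<close> and \<open>C_separating\<close> does not depend on the target
    graph.\<close>
  moreover have "lu_hom (crown_graph r P) (C23_graph r C) \<phi>"
    if "lu_hom (crown_graph r P) (C3_graph r C) \<phi>" for \<phi>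
    using that unfolding lu_hom_def C3_graph_def induced_lu_graph_def by auto
  ultimately show "\<exists>\<phi>. lu_hom (crown_graph r P) (C23_graph r C) \<phi> \<and> C_separating r P C a b v w \<phi>"
    by blast
next
  assume "\<exists>\<phi>. lu_hom (crown_graph r P) (C23_graph r C) \<phi> \<and> C_separating r P C a b v w \<phi>"
  then obtain \<phi> where hom: "lu_hom (crown_graph r P) (C23_graph r C) \<phi>"
    and sep: "C_separating r P C a b v w \<phi>" by blast
  let ?\<F> = "improper_extremal_crowns r P"
  have \<phi>: "\<phi> F \<in> C23 r C" if "F \<in> ?\<F>" for F
    using hom that
    unfolding lu_hom_def crown_graph_def C23_graph_def intersection_lu_graph_def by auto
  \<comment> \<open>One enlargement is fixed for each \<open>S\<close>; the new homomorphism is then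
    \<open>g \<circ> \<phi>\<close>.\<close>
  have "\<exists>g. \<forall>S\<in>C23 r C. g S \<in> C3 r C \<and> S \<subseteq> g S"
    using C23_extend[OF assms(5)] by (intro bchoice) blast
  then obtain g where g: "\<And>S. S \<in> C23 r C \<Longrightarrow> g S \<in> C3 r C"
    and g_sup: "\<And>S. S \<in> C23 r C \<Longrightarrow> S \<subseteq> g S" by blast
  have C3_C23: "S \<in> C23 r C" if "S \<in> C3 r C" for S
    using that unfolding C3_def by blast
  have "lu_hom (crown_graph r P) (C3_graph r C) (g \<circ> \<phi>)"
  proof -
    have "min_points r C \<inter> g (\<phi> F) \<inter> g (\<phi> G) \<noteq> {}"
      if "F \<in> ?\<F>" "G \<in> ?\<F>" "min_points r P \<inter> F \<inter> G \<noteq> {}" for F G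
    proof -
      have "min_points r C \<inter> \<phi> F \<inter> \<phi> G \<noteq> {}"
        using hom that
        unfolding lu_hom_def crown_graph_def C23_graph_def intersection_lu_graph_def by auto
      then show ?thesis using g_sup[OF \<phi>] that by blast
    qed
    moreover have "max_points r C \<inter> g (\<phi> F) \<inter> g (\<phi> G) \<noteq> {}"
      if "F \<in> ?\<F>" "G \<in> ?\<F>" "max_points r P \<inter> F \<inter> G \<noteq> {}" for F G
    proof -
      have "max_points r C \<inter> \<phi> F \<inter> \<phi> G \<noteq> {}"
        using hom that
        unfolding lu_hom_def crown_graph_def C23_graph_def intersection_lu_graph_def by auto
      then show ?thesis using g_sup[OF \<phi>] that by blast
    qed
    ultimately show ?thesis
      using g[OF \<phi>] C3_C23[OF g[OF \<phi>]]
      unfolding lu_hom_def crown_graph_def C3_graph_def C23_graph_def induced_lu_graph_def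
        intersection_lu_graph_def
      by auto
  qed
  moreover have "C_separating r P C a b v w (g \<circ> \<phi>)"
  proof -
    \<comment> \<open>Here \<open>M \<inter> S\<close> is a non-empty subset of the singleton
      \<open>M \<inter> T\<close>. With \<open>M\<close> a level of \<open>C\<close>, this pulls
      membership in a class back from \<open>g (\<phi> F)\<close> to
      \<open>\<phi> F\<close>.\<close>
    have single: "M \<inter> S = {c}" if "M \<inter> T = {c}" "S \<subseteq> T" "M \<inter> S \<noteq> {}" for M S T :: "'a set" and c
      using that by (metis Int_mono order_refl subset_singletonD)
    have lower: "\<phi> F \<in> lower_class r C c" if "F \<in> ?\<F>" "g (\<phi> F) \<in> lower_class r C c" for F c
      using that single[OF _ g_sup[OF \<phi>] C23_meets_extremal_points(1)[OF assms(2,5) \<phi>]] \<phi>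
      unfolding lower_class_def by simp
    have upper: "\<phi> F \<in> upper_class r C c" if "F \<in> ?\<F>" "g (\<phi> F) \<in> upper_class r C c" for F c
      using that single[OF _ g_sup[OF \<phi>] C23_meets_extremal_points(2)[OF assms(2,5) \<phi>]] \<phi>
      unfolding upper_class_def by simp
    obtain x x' y y' where
      xy: "x \<in> min_points r P" "x' \<in> min_points r P" "x \<noteq> x'"
      "y \<in> max_points r P" "y' \<in> max_points r P" "y \<noteq> y'" "{x, x', y, y'} = C"
      and sep': "\<forall>F\<in>?\<F>. (x \<in> F \<longrightarrow> \<phi> F \<notin> lower_class r C a) \<and>
        (x' \<in> F \<longrightarrow> \<phi> F \<notin> lower_class r C b) \<and>
        (y \<in> F \<longrightarrow> \<phi> F \<notin> upper_class r C v) \<and>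
        (y' \<in> F \<longrightarrow> \<phi> F \<notin> upper_class r C w)"
      using sep unfolding C_separating_def by (elim exE conjE)
    \<comment> \<open>The points that witness separation for \<open>\<phi>\<close> are kept; each
      conjunct is the contrapositive of \<open>lower\<close> or \<open>upper\<close>.\<close>
    have "(x \<in> F \<longrightarrow> (g \<circ> \<phi>) F \<notin> lower_class r C a) \<and>
        (x' \<in> F \<longrightarrow> (g \<circ> \<phi>) F \<notin> lower_class r C b) \<and>
        (y \<in> F \<longrightarrow> (g \<circ> \<phi>) F \<notin> upper_class r C v) \<and>
        (y' \<in> F \<longrightarrow> (g \<circ> \<phi>) F \<notin> upper_class r C w)" if "F \<in> ?\<F>" for F
      using bspec[OF sep' that] lower[OF that, of a] lower[OF that, of b]
        upper[OF that, of v] upper[OF that, of w]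
      unfolding comp_apply by argo
    with xy show ?thesis
      unfolding C_separating_def
      by - (rule exI[of _ x], rule exI[of _ x'], rule exI[of _ y], rule exI[of _ y'], simp)
  qed
  ultimately show "\<exists>\<phi>. lu_hom (crown_graph r P) (C3_graph r C) \<phi> \<and> C_separating r P C a b v w \<phi>"
    by blast
qed

end
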